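(* Let $M^\star$ be the minimal sufficient mask and let $M_{\mathcal E}\supseteq M^\star$ be the mask selected by the entropy criterion, with cell count $K(M_{\mathcal E})$ treated as fixed. Let $N_s$ be the number of observations. Assume that for each of the two masks $M\in\{M_{\mathcal E},M^\star\}$ the cells are balanced, i.e. $n_k = N_s/K(M)$ for every cell $k=1,\dots,K(M)$, and that $\hat R^2(M)$ is evaluated on observations independent of those used to form the cell mean estimates $\hat\mu_{B_k}$. Then $$\delta := \mathbb{E}[\hat R^2(M_{\mathcal E})]-\mathbb{E}[\hat R^2(M^\star)] = \frac{\sigma_\varepsilon^2}{N_s}\bigl(K(M_{\mathcal E})-K(M^\star)\bigr).$$ Moreover $\delta\ge 0$, and $\delta$ is monotone increasing in $K(M_{\mathcal E})-K(M^\star)$ and in $\sigma_\varepsilon^2$, and monotone decreasing in $N_s$.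
   Context: There are $d$ input variables; variable $i$ takes $q_i$ discrete values, and $X_t^i$ is its value at time $t$. A mask is a subset $M\subseteq\{1,\dots,d\}\times\{0,\dots,L\}$ of (variable, lag) pairs; the associated input symbol is the tuple $X_t^M=(X_{t-\ell}^i)_{(i,\ell)\in M}$. It takes one of $K(M)=\prod_{(i,\ell)\in M}q_i$ possible values; each possible value defines an input cell $B_k$, $k=1,\dots,K(M)$. The output is $Y_t$. A mask $M^\star$ is minimal sufficient if, for all $t$, $Y_t$ is conditionally independent of all inputs not in $X_t^{M^\star}$ given $X_t^{M^\star}$, and no proper subset of $M^\star$ has this property. Output model: an observation falling in cell $B_k$ (for a mask containing $M^\star$) has output $y=\mu_k+\varepsilon$, where $\mu_k$ is the conditional mean of the output, constant on the cell, and $\varepsilon\sim\mathcal N(0,\sigma_\varepsilon^2)$; the noise terms of distinct observations are independent. For a mask $M$, $n_k$ denotes the number of the $N_s$ observations (those used for estimation) lying in cell $B_k$, with $n_k\ge 1$ for all $k$ and $\sum_k n_k=N_s$, and $\hat\mu_{B_k}$ is the sample average of the outputs of these $n_k$ observations. The empirical mean squared error is $\hat R^2(M)=\frac1{N_s}\sum_{i=1}^{N_s}(y_i-\hat\mu_{B_i})^2$, where $i$ runs over the evaluation observations, $y_i$ is the output of observation $i$, and $\hat\mu_{B_i}$ is the estimated mean of the cell containing it; the evaluation observations are distributed over the cells in the same (balanced) proportions. The entropy criterion selects $M_{\mathcal E}=\arg\min_M\hat H(M)$ over candidate masks, where $\hat H(M)=\sum_k\hat P(B_k)\bigl(-\sum_j\hat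 p_{jk}\log_2\hat p_{jk}\bigr)$ is the empirical conditional entropy, with $\hat P(B_k)$ the empirical frequency of cell $B_k$ and $\hat p_{jk}$ the empirical frequency of output value $j$ among observations in $B_k$. *)

theory Defs
  imports "HOL-Probability.Probability"
begin

text \<open>A mask is a set of (variable, lag) pairs; a cell of a mask is one possible value of its
  input symbol, represented as an extensional function on the mask.\<close>

type_synonym mask = "(nat \<times> nat) set"
type_synonym cell = "nat \<times> nat \<Rightarrow> nat"

definition full_mask :: "nat \<Rightarrow> nat \<Rightarrow> mask" where
  "full_mask d L = {1..d} \<times> {0..L}"

definition cells :: "(nat \<Rightarrow> nat) \<Rightarrow> mask \<Rightarrow> cell set" where
  "cells q M = (\<Pi>\<^sub>E (i, l)\<in>M. {..<q i})"

definition num_cells :: "(nat \<Rightarrow> nat) \<Rightarrow> mask \<Rightarrow> nat" where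
  "num_cells q M = (\<Prod>(i, l)\<in>M. q i)"

definition input_symbol ::
  "(nat \<Rightarrow> int \<Rightarrow> 'w \<Rightarrow> nat) \<Rightarrow> mask \<Rightarrow> int \<Rightarrow> 'w \<Rightarrow> cell" where
  "input_symbol X M t \<omega> = (\<lambda>(i, l)\<in>M. X i (t - int l) \<omega>)"

text \<open>\<open>U\<close> and \<open>V\<close> are conditionally independent given (the sigma-algebra generated by) \<open>Z\<close>.\<close>

definition cond_indep_given ::
  "'w measure \<Rightarrow> 'z measure \<Rightarrow> ('w \<Rightarrow> 'z) \<Rightarrow> 'u measure \<Rightarrow> ('w \<Rightarrow> 'u) \<Rightarrow>
   'v measure \<Rightarrow> ('w \<Rightarrow> 'v) \<Rightarrow> bool" where
  "cond_indep_given P SZ Z SU U SV V \<longleftrightarrow>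
     (let G = vimage_algebra (space P) Z SZ in
      \<forall>A\<in>sets SU. \<forall>B\<in>sets SV. AE \<omega> in P.
        real_cond_exp P G (indicator (U -` A \<inter> V -` B \<inter> space P)) \<omega> =
        real_cond_exp P G (indicator (U -` A \<inter> space P)) \<omega> *
        real_cond_exp P G (indicator (V -` B \<inter> space P)) \<omega>)"

text \<open>Independence of two random variables, as in \<^const>\<open>prob_space.indep_var\<close> but without the
  restriction that both have the same value type.\<close>

definition indep_rv ::
  "'w measure \<Rightarrow> 'u measure \<Rightarrow> ('w \<Rightarrow> 'u) \<Rightarrow> 'v measure \<Rightarrow> ('w \<Rightarrow> 'v) \<Rightarrow> bool" where
  "indep_rv P SU U SV V \<longleftrightarrow>
     U \<in> measurable P SU \<and> V \<in> measurable P SV \<and>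
     prob_space.indep_set P
       (sets (vimage_algebra (space P) U SU)) (sets (vimage_algebra (space P) V SV))"

definition sufficient_mask ::
  "'w measure \<Rightarrow> mask \<Rightarrow> (nat \<Rightarrow> nat) \<Rightarrow> (nat \<Rightarrow> int \<Rightarrow> 'w \<Rightarrow> nat) \<Rightarrow> (int \<Rightarrow> 'w \<Rightarrow> real) \<Rightarrow>
   mask \<Rightarrow> bool" where
  "sufficient_mask P F q X Y M \<longleftrightarrow> M \<subseteq> F \<and>
     (\<forall>t. cond_indep_given P (count_space (cells q M)) (input_symbol X M t)
            borel (Y t)
            (count_space (cells q (F - M))) (input_symbol X (F - M) t))"

definition minimal_sufficient_mask ::
  "'w measure \<Rightarrow> mask \<Rightarrow> (nat \<Rightarrow> nat) \<Rightarrow> (nat \<Rightarrow> int \<Rightarrow> 'w \<Rightarrow> nat) \<Rightarrow> (int \<Rightarrow> 'w \<Rightarrow> real) \<Rightarrow>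
   mask \<Rightarrow> bool" where
  "minimal_sufficient_mask P F q X Y M \<longleftrightarrow>
     sufficient_mask P F q X Y M \<and> (\<forall>M'. M' \<subset> M \<longrightarrow> \<not> sufficient_mask P F q X Y M')"

definition obs_in_cell ::
  "(nat \<Rightarrow> int \<Rightarrow> 'w \<Rightarrow> nat) \<Rightarrow> int set \<Rightarrow> mask \<Rightarrow> cell \<Rightarrow> 'w \<Rightarrow> int set" where
  "obs_in_cell X T M B \<omega> = {t \<in> T. input_symbol X M t \<omega> = B}"

definition balanced ::
  "'w measure \<Rightarrow> (nat \<Rightarrow> nat) \<Rightarrow> (nat \<Rightarrow> int \<Rightarrow> 'w \<Rightarrow> nat) \<Rightarrow> int set \<Rightarrow> mask \<Rightarrow> bool" where
  "balanced P q X T M \<longleftrightarrow> (AE \<omega> in P. \<forall>B\<in>cells q M.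
     card (obs_in_cell X T M B \<omega>) \<ge> 1 \<and>
     real (card (obs_in_cell X T M B \<omega>)) = real (card T) / real (num_cells q M))"

definition cell_average ::
  "(nat \<Rightarrow> int \<Rightarrow> 'w \<Rightarrow> nat) \<Rightarrow> (int \<Rightarrow> 'w \<Rightarrow> real) \<Rightarrow> int set \<Rightarrow> mask \<Rightarrow> cell \<Rightarrow> 'w \<Rightarrow> real" where
  "cell_average X Y T M B \<omega> =
     (\<Sum>t\<in>obs_in_cell X T M B \<omega>. Y t \<omega>) / real (card (obs_in_cell X T M B \<omega>))"

text \<open>Cell averages are formed on the times \<open>T\<close>, squared errors are averaged over the times \<open>E\<close>.\<close>

definition empirical_mse ::
  "(nat \<Rightarrow> int \<Rightarrow> 'w \<Rightarrow> nat) \<Rightarrow> (int \<Rightarrow> 'w \<Rightarrow> real) \<Rightarrow> int set \<Rightarrow> int set \<Rightarrow> mask \<Rightarrow> 'w \<Rightarrow> real" where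
  "empirical_mse X Y T E M \<omega> =
     1 / real (card E) *
       (\<Sum>t\<in>E. (Y t \<omega> - cell_average X Y T M (input_symbol X M t \<omega>) \<omega>)\<^sup>2)"

text \<open>The map \<open>g\<close> assigns to a real output its discrete output value (the identity if the raw
  outputs are used). Since \<open>log 2 0 = 0\<close> and \<open>x / 0 = 0\<close>, values not occurring in a cell and
  empty cells contribute nothing.\<close>

definition empirical_cond_entropy ::
  "(nat \<Rightarrow> nat) \<Rightarrow> (nat \<Rightarrow> int \<Rightarrow> 'w \<Rightarrow> nat) \<Rightarrow> (int \<Rightarrow> 'w \<Rightarrow> real) \<Rightarrow> (real \<Rightarrow> real) \<Rightarrow> int set \<Rightarrow>
   mask \<Rightarrow> 'w \<Rightarrow> real" where
  "empirical_cond_entropy q X Y g T M \<omega> =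
     (\<Sum>B\<in>cells q M.
        let C = obs_in_cell X T M B \<omega>;
            p = (\<lambda>j. real (card {t \<in> C. g (Y t \<omega>) = j}) / real (card C))
        in real (card C) / real (card T) *
             (- (\<Sum>j\<in>(\<lambda>t. g (Y t \<omega>)) ` T. p j * log 2 (p j))))"

text \<open>\<open>test\<close> are the times of the evaluation observations, \<open>train\<close> those of the observations used
  for estimation, \<open>realization\<close> is the outcome at which the data entering the entropy criterion
  were observed.\<close>

record 'w study =
  prob :: "'w measure"
  num_vars :: nat
  max_lag :: nat
  levels :: "nat \<Rightarrow> nat"
  inputs :: "nat \<Rightarrow> int \<Rightarrow> 'w \<Rightarrow> nat"
  outputs :: "int \<Rightarrow> 'w \<Rightarrow> real"
  noise :: "int \<Rightarrow> 'w \<Rightarrow> real"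
  cell_mean :: "mask \<Rightarrow> cell \<Rightarrow> real"
  noise_sd :: real
  train :: "int set"
  test :: "int set"
  quantizer :: "real \<Rightarrow> real"
  candidates :: "mask set"
  realization :: 'w
  mask_star :: mask
  mask_ent :: mask

abbreviation all_inputs :: "'w study \<Rightarrow> mask" where
  "all_inputs S \<equiv> full_mask (num_vars S) (max_lag S)"

definition wf_process :: "'w study \<Rightarrow> bool" where
  "wf_process S \<longleftrightarrow>
     prob_space (prob S) \<and>
     (\<forall>i\<in>{1..num_vars S}. \<forall>t. inputs S i t \<in> measurable (prob S) (count_space {..<levels S i})) \<and>
     (\<forall>t. outputs S t \<in> borel_measurable (prob S))"

text \<open>The noise is independent of the inputs: whatever cell an observation falls in, its noise is
  drawn from the same normal law. The cell mean does not depend on the time.\<close>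

definition output_model :: "'w study \<Rightarrow> bool" where
  "output_model S \<longleftrightarrow>
     (let P = prob S; T = train S \<union> test S; F = all_inputs S; q = levels S; X = inputs S in
      noise_sd S > 0 \<and>
      (\<forall>M. mask_star S \<subseteq> M \<and> M \<subseteq> F \<longrightarrow> (\<forall>t\<in>T.
         (AE \<omega> in P. outputs S t \<omega> = cell_mean S M (input_symbol X M t \<omega>) + noise S t \<omega>) \<and>
         (AE \<omega> in P. real_cond_exp P
            (vimage_algebra (space P) (input_symbol X M t) (count_space (cells q M)))
            (outputs S t) \<omega> = cell_mean S M (input_symbol X M t \<omega>)))) \<and>
      (\<forall>t\<in>T. distributed P lborel (noise S t) (normal_density 0 (noise_sd S))) \<and>
      prob_space.indep_vars P (\<lambda>_. borel) (noise S) T \<and>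
      indep_rv P
        (\<Pi>\<^sub>M t\<in>T. borel) (\<lambda>\<omega>. \<lambda>t\<in>T. noise S t \<omega>)
        (\<Pi>\<^sub>M t\<in>T. count_space (cells q F)) (\<lambda>\<omega>. \<lambda>t\<in>T. input_symbol X F t \<omega>))"

definition independent_evaluation :: "'w study \<Rightarrow> bool" where
  "independent_evaluation S \<longleftrightarrow>
     (let obs = (\<lambda>t \<omega>. (input_symbol (inputs S) (all_inputs S) t \<omega>, outputs S t \<omega>));
          OS = count_space (cells (levels S) (all_inputs S)) \<Otimes>\<^sub>M borel in
      finite (train S) \<and> finite (test S) \<and> train S \<inter> test S = {} \<and>
      card (test S) = card (train S) \<and>
      prob_space.indep_var (prob S)
        (\<Pi>\<^sub>M t\<in>train S. OS) (\<lambda>\<omega>. \<lambda>t\<in>train S. obs t \<omega>)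
        (\<Pi>\<^sub>M t\<in>test S. OS) (\<lambda>\<omega>. \<lambda>t\<in>test S. obs t \<omega>))"

text \<open>The selected mask is the minimizer for the observed data; it is a fixed mask, not a random
  variable, when expectations are taken.\<close>

definition entropy_selected :: "'w study \<Rightarrow> bool" where
  "entropy_selected S \<longleftrightarrow>
     candidates S \<subseteq> Pow (all_inputs S) \<and> realization S \<in> space (prob S) \<and>
     is_arg_min
       (\<lambda>M. empirical_cond_entropy (levels S) (inputs S) (outputs S) (quantizer S) (train S) M
              (realization S))
       (\<lambda>M. M \<in> candidates S) (mask_ent S)"

definition balanced_study :: "'w study \<Rightarrow> bool" where
  "balanced_study S \<longleftrightarrow>
     wf_process S \<and>
     minimal_sufficient_mask (prob S) (all_inputs S) (levels S) (inputs S) (outputs S)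
       (mask_star S) \<and>
     output_model S \<and>
     entropy_selected S \<and> mask_star S \<subseteq> mask_ent S \<and>
     independent_evaluation S \<and>
     (\<forall>M\<in>{mask_ent S, mask_star S}.
        balanced (prob S) (levels S) (inputs S) (train S) M \<and>
        balanced (prob S) (levels S) (inputs S) (test S) M)"

definition N_s :: "'w study \<Rightarrow> nat" where
  "N_s S = card (train S)"

definition R2_hat :: "'w study \<Rightarrow> mask \<Rightarrow> 'w \<Rightarrow> real" where
  "R2_hat S M = empirical_mse (inputs S) (outputs S) (train S) (test S) M"

definition \<delta> :: "'w study \<Rightarrow> real" where
  "\<delta> S = prob_space.expectation (prob S) (R2_hat S (mask_ent S)) -
         prob_space.expectation (prob S) (R2_hat S (mask_star S))"

definition cell_excess :: "'w study \<Rightarrow> real" where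
  "cell_excess S =
     real (num_cells (levels S) (mask_ent S)) - real (num_cells (levels S) (mask_star S))"

end

theory Submission imports Defs begin

text \<open>On a mask containing the minimal sufficient one the cell means cancel from every residual, so
  the residual of an evaluation observation is a linear combination of the noise terms whose
  coefficients depend on the inputs only: weight \<open>1\<close> on the observation's own noise and weight
  \<open>- K / N\<^sub>s\<close> on the noise of the \<open>N\<^sub>s / K\<close> training observations of its cell. The noise
  is independent of the inputs and orthogonal with variance \<open>\<sigma>\<^sup>2\<close>, so the expected
  squared residual is \<open>\<sigma>\<^sup>2\<close> times the sum of the squared coefficients, that is
  \<open>\<sigma>\<^sup>2 (1 + K / N\<^sub>s)\<close>. All claims follow from this formula.\<close>

section \<open>Measurability and independence tools\<close>

text \<open>For a fixed value of \<open>f\<close> only a singleton test on \<open>g\<close> remains.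
  Countability of \<open>A\<close> then glues the pieces; on an uncountable discrete space the
  diagonal need not be measurable in the product.\<close>

lemma borel_measurable_of_bool_eq:
  assumes "f \<in> N \<rightarrow>\<^sub>M count_space A" "g \<in> N \<rightarrow>\<^sub>M count_space A" "countable A"
  shows "(\<lambda>x. of_bool (f x = g x) :: real) \<in> borel_measurable N"
proof -
  have "(\<lambda>x. of_bool (c = g x) :: real) \<in> borel_measurable N" if "c \<in> A" for c
    by (rule measurable_compose[OF assms(2)]) simp
  from measurable_compose_countable'[OF this assms(1,3)] show ?thesis by simp
qed

text \<open>The sigma-algebra generated by a function of \<open>U\<close> lies inside the one
  generated by \<open>U\<close>, and independence passes to smaller families. Since \<open>f\<close>
  and \<open>g\<close> have values in one common type, the library results on
  \<open>indep_var\<close> become available.\<close>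

lemma (in prob_space) indep_var_of_indep_rv:
  assumes "indep_rv M SU U SV V" "f \<in> SU \<rightarrow>\<^sub>M SA" "g \<in> SV \<rightarrow>\<^sub>M SB"
  shows "indep_var SA (\<lambda>\<omega>. f (U \<omega>)) SB (\<lambda>\<omega>. g (V \<omega>))"
proof -
  have meas: "U \<in> M \<rightarrow>\<^sub>M SU" "V \<in> M \<rightarrow>\<^sub>M SV"
    and ind: "indep_set (sets (vimage_algebra (space M) U SU)) (sets (vimage_algebra (space M) V SV))"
    using assms(1) by (auto simp: indep_rv_def)
  have sub: "sigma_sets (space M) {(\<lambda>\<omega>. h (W \<omega>)) -` A \<inter> space M | A. A \<in> sets SC}
      \<subseteq> sets (vimage_algebra (space M) W SW)"
    if W: "W \<in> M \<rightarrow>\<^sub>M SW" and h: "h \<in> SW \<rightarrow>\<^sub>M SC" for W h and SW :: "'e measure" and SC :: "'f measure"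
  proof -
    have "W \<in> vimage_algebra (space M) W SW \<rightarrow>\<^sub>M SW"
      using measurable_space[OF W] by (intro measurable_vimage_algebra1) auto
    then have "(\<lambda>\<omega>. h (W \<omega>)) \<in> vimage_algebra (space M) W SW \<rightarrow>\<^sub>M SC"
      using h by (rule measurable_compose)
    then have "{(\<lambda>\<omega>. h (W \<omega>)) -` A \<inter> space M | A. A \<in> sets SC}
        \<subseteq> sets (vimage_algebra (space M) W SW)"
      by (auto dest: measurable_sets)
    from sets.sigma_sets_subset[OF this] show ?thesis by simp
  qed
  have "indep_set
      (sigma_sets (space M) {(\<lambda>\<omega>. f (U \<omega>)) -` A \<inter> space M | A. A \<in> sets SA})
      (sigma_sets (space M) {(\<lambda>\<omega>. g (V \<omega>)) -` A \<inter> space M | A. A \<in> sets SB})"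
    using ind sub[OF meas(1) assms(2)] sub[OF meas(2) assms(3)]
    unfolding indep_sets2_eq by blast
  then show ?thesis
    using measurable_compose[OF meas(1) assms(2)] measurable_compose[OF meas(2) assms(3)]
    by (simp add: indep_var_eq)
qed

section \<open>Second moments of noise combinations with random coefficients\<close>

text \<open>After expanding the square, each term is a product of two noise variables times a
  product of two coefficients. These two factors are independent, so the expectation splits, and
  orthogonality leaves the diagonal only. Boundedness of the coefficients provides
  integrability.\<close>

lemma (in prob_space) second_moment_random_combination:
  fixes e :: "'i \<Rightarrow> 'a \<Rightarrow> real" and a :: "'i \<Rightarrow> 'z \<Rightarrow> real"
  assumes "finite T"
    and indep: "indep_rv M (\<Pi>\<^sub>M s\<in>T. borel) (\<lambda>\<omega>. \<lambda>s\<in>T. e s \<omega>) SZ Z"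
    and int: "\<And>r s. r \<in> T \<Longrightarrow> s \<in> T \<Longrightarrow> integrable M (\<lambda>\<omega>. e r \<omega> * e s \<omega>)"
    and orth: "\<And>r s. r \<in> T \<Longrightarrow> s \<in> T \<Longrightarrow> expectation (\<lambda>\<omega>. e r \<omega> * e s \<omega>) = (if r = s then v else 0)"
    and a: "\<And>s. s \<in> T \<Longrightarrow> a s \<in> borel_measurable SZ"
    and bd: "\<And>s z. s \<in> T \<Longrightarrow> \<bar>a s z\<bar> \<le> C"
  shows "integrable M (\<lambda>\<omega>. (\<Sum>s\<in>T. a s (Z \<omega>) * e s \<omega>)\<^sup>2)" (is ?int)
    and "expectation (\<lambda>\<omega>. (\<Sum>s\<in>T. a s (Z \<omega>) * e s \<omega>)\<^sup>2)
      = v * expectation (\<lambda>\<omega>. \<Sum>s\<in>T. (a s (Z \<omega>))\<^sup>2)" (is ?eq)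
proof -
  have Z: "Z \<in> M \<rightarrow>\<^sub>M SZ" using indep by (simp add: indep_rv_def)
  have inta: "integrable M (\<lambda>\<omega>. a r (Z \<omega>) * a s (Z \<omega>))" if "r \<in> T" "s \<in> T" for r s
  proof (rule integrable_const_bound[where B = "C * C"])
    show "AE \<omega> in M. norm (a r (Z \<omega>) * a s (Z \<omega>)) \<le> C * C"
      using bd[OF that(1)] bd[OF that(2)] by (auto simp: abs_mult intro!: mult_mono' AE_I2)
    show "(\<lambda>\<omega>. a r (Z \<omega>) * a s (Z \<omega>)) \<in> borel_measurable M"
      using a[OF that(1)] a[OF that(2)] Z by measurable
  qed
  have ind: "indep_var borel (\<lambda>\<omega>. e r \<omega> * e s \<omega>) borel (\<lambda>\<omega>. a r (Z \<omega>) * a s (Z \<omega>))"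
    if "r \<in> T" "s \<in> T" for r s
  proof -
    \<comment> \<open>Both products are written as functions of whole tuples to match
      \<open>indep_rv\<close>; the restriction to \<open>T\<close> then disappears because
      \<open>r\<close> and \<open>s\<close> lie in \<open>T\<close>.\<close>
    have "indep_var borel (\<lambda>\<omega>. (\<lambda>x. x r * x s) (\<lambda>s\<in>T. e s \<omega>)) borel (\<lambda>\<omega>. (\<lambda>z. a r z * a s z) (Z \<omega>))"
      by (rule indep_var_of_indep_rv[OF indep]) (use that a in measurable)
    then show ?thesis using that by simp
  qed
  have sq: "(\<Sum>s\<in>T. a s (Z \<omega>) * e s \<omega>)\<^sup>2
      = (\<Sum>r\<in>T. \<Sum>s\<in>T. (e r \<omega> * e s \<omega>) * (a r (Z \<omega>) * a s (Z \<omega>)))" for \<omega>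
    by (simp add: power2_eq_square sum_product ac_simps)
  have int': "integrable M (\<lambda>\<omega>. (e r \<omega> * e s \<omega>) * (a r (Z \<omega>) * a s (Z \<omega>)))"
    if "r \<in> T" "s \<in> T" for r s
    by (rule indep_var_integrable[OF ind int inta]) (use that in auto)
  then show ?int unfolding sq by auto
  have "expectation (\<lambda>\<omega>. (\<Sum>s\<in>T. a s (Z \<omega>) * e s \<omega>)\<^sup>2)
      = (\<Sum>r\<in>T. \<Sum>s\<in>T. expectation (\<lambda>\<omega>. (e r \<omega> * e s \<omega>) * (a r (Z \<omega>) * a s (Z \<omega>))))"
    unfolding sq using int' by (simp add: Bochner_Integration.integral_sum)
  also have "\<dots> = (\<Sum>r\<in>T. \<Sum>s\<in>T. if r = s then v * expectation (\<lambda>\<omega>. a r (Z \<omega>) * a s (Z \<omega>)) else 0)"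
    by (intro sum.cong refl) (simp add: indep_var_lebesgue_integral[OF ind int inta] orth)
  also have "\<dots> = v * (\<Sum>r\<in>T. expectation (\<lambda>\<omega>. (a r (Z \<omega>))\<^sup>2))"
    using \<open>finite T\<close> by (simp add: sum_distrib_left power2_eq_square)
  also have "\<dots> = v * expectation (\<lambda>\<omega>. \<Sum>r\<in>T. (a r (Z \<omega>))\<^sup>2)"
    using inta by (simp add: Bochner_Integration.integral_sum power2_eq_square)
  finally show ?eq .
qed

text \<open>On the diagonal the mean is zero, so the second moment is the variance. Off the
  diagonal, independence turns the expectation into a product of zero means.\<close>

lemma (in prob_space) centered_normal_second_moments:
  assumes "\<sigma> > 0" "indep_vars (\<lambda>_. borel) e T"
    and dist: "\<And>s. s \<in> T \<Longrightarrow> distributed M lborel (e s) (normal_density 0 \<sigma>)"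
    and rs: "r \<in> T" "s \<in> T"
  shows "integrable M (\<lambda>\<omega>. e r \<omega> * e s \<omega>)"
    and "expectation (\<lambda>\<omega>. e r \<omega> * e s \<omega>) = (if r = s then \<sigma>\<^sup>2 else 0)"
proof -
  have mean: "expectation (e t) = 0" if "t \<in> T" for t
    using normal_distributed_expectation[OF assms(1) dist[OF that]] .
  have int: "integrable M (e t)" if "t \<in> T" for t
    using distributed_integrable_var[OF dist[OF that]] integrable_normal_moment[OF assms(1), of 0 1]
    by simp
  have "integrable M (\<lambda>\<omega>. e r \<omega> * e s \<omega>) \<and>
      expectation (\<lambda>\<omega>. e r \<omega> * e s \<omega>) = (if r = s then \<sigma>\<^sup>2 else 0)"
  proof (cases "r = s")
    case True
    have "integrable M (\<lambda>\<omega>. (e r \<omega>)\<^sup>2)"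
      using distributed_integrable[OF dist[OF rs(1)], of "\<lambda>x. x\<^sup>2"]
        integrable_normal_moment[OF assms(1), of 0 2] by simp
    moreover have "expectation (\<lambda>\<omega>. (e r \<omega>)\<^sup>2) = \<sigma>\<^sup>2"
      using normal_distributed_variance[OF assms(1) dist[OF rs(1)]] mean[OF rs(1)] by simp
    ultimately show ?thesis using True by (simp add: power2_eq_square)
  next
    case False
    have ind: "indep_vars (\<lambda>_. borel) e {r, s}"
      using assms(2) by (rule indep_vars_subset) (use rs in auto)
    show ?thesis
      using indep_vars_lebesgue_integral[OF _ ind] indep_vars_integrable[OF _ ind] int mean rs False
      by auto
  qed
  then show "integrable M (\<lambda>\<omega>. e r \<omega> * e s \<omega>)"
    and "expectation (\<lambda>\<omega>. e r \<omega> * e s \<omega>) = (if r = s then \<sigma>\<^sup>2 else 0)" by auto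
qed

section \<open>Masks, cells and cell counts\<close>

lemma finite_full_mask: "finite (full_mask d L)"
  by (simp add: full_mask_def)

lemma finite_cells: "finite M \<Longrightarrow> finite (cells q M)"
  unfolding cells_def by (rule finite_PiE) auto

text \<open>Through this identity the cell for a smaller mask becomes a function of the full input
  symbol, and it is the full symbols that \<open>output_model\<close> declares independent of the
  noise.\<close>

lemma input_symbol_restrict:
  "M \<subseteq> F \<Longrightarrow> input_symbol X M t \<omega> = restrict (input_symbol X F t \<omega>) M"
  by (auto simp: input_symbol_def restrict_def fun_eq_iff)

lemma restrict_in_cells: "M \<subseteq> F \<Longrightarrow> z \<in> cells q F \<Longrightarrow> restrict z M \<in> cells q M"
  unfolding cells_def by (auto simp: PiE_iff)

text \<open>The random index set is traded for a fixed one with random 0/1 weights, so that sums can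
  be exchanged with expectations.\<close>

lemma cell_average_eq_weighted:
  assumes "finite T"
  shows "cell_average X Y T M (input_symbol X M t \<omega>) \<omega> =
    (\<Sum>s\<in>T. of_bool (input_symbol X M s \<omega> = input_symbol X M t \<omega>) * Y s \<omega>) /
    (\<Sum>s\<in>T. of_bool (input_symbol X M s \<omega> = input_symbol X M t \<omega>))"
  unfolding cell_average_def obs_in_cell_def using assms
  by (simp add: sum.inter_filter[symmetric] of_bool_def sum.If_cases if_distrib[of "\<lambda>x. x * _"] Int_def
      cong: if_cong)

lemma input_symbol_in_cells:
  assumes "wf_process S" "M \<subseteq> all_inputs S" "\<omega> \<in> space (prob S)"
  shows "input_symbol (inputs S) M t \<omega> \<in> cells (levels S) M"
proof -
  have "inputs S i u \<omega> < levels S i" if "(i, l) \<in> M" for i l u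
  proof -
    have "i \<in> {1..num_vars S}" using that assms(2) by (auto simp: full_mask_def)
    then have "inputs S i u \<in> prob S \<rightarrow>\<^sub>M count_space {..<levels S i}"
      using assms(1) unfolding wf_process_def by blast
    from measurable_space[OF this assms(3)] show ?thesis by simp
  qed
  then show ?thesis by (auto simp: input_symbol_def cells_def)
qed

text \<open>A probability space has an outcome, whose input symbol is a cell; hence no factor of the
  product can vanish.\<close>

lemma num_cells_pos:
  assumes "wf_process S" "M \<subseteq> all_inputs S"
  shows "num_cells (levels S) M > 0"
proof -
  interpret prob_space "prob S" using assms(1) by (simp add: wf_process_def)
  obtain \<omega> where "\<omega> \<in> space (study.prob S)" using not_empty by blast
  then have "cells (levels S) M \<noteq> {}" using input_symbol_in_cells[OF assms] by blast
  then have "\<forall>x\<in>M. 0 < (case x of (i, l) \<Rightarrow> levels S i)"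
    by (auto simp: cells_def PiE_eq_empty_iff)
  then show ?thesis unfolding num_cells_def by (intro prod_pos) blast
qed

text \<open>The count for \<open>M'\<close> is the count for \<open>M\<close> times that for
  \<open>M' - M\<close>, and the latter factor is at least one.\<close>

lemma num_cells_mono:
  assumes "wf_process S" "M \<subseteq> M'" "M' \<subseteq> all_inputs S"
  shows "num_cells (levels S) M \<le> num_cells (levels S) M'"
proof -
  have fin: "finite M'" using assms(3) finite_full_mask finite_subset by blast
  have "num_cells (levels S) M' = num_cells (levels S) M * num_cells (levels S) (M' - M)"
    unfolding num_cells_def using fin assms(2) by (simp add: prod.subset_diff mult.commute)
  moreover have "num_cells (levels S) (M' - M) > 0"
    using assms by (intro num_cells_pos) auto
  ultimately show ?thesis by simp
qed

section \<open>Expected error of one mask containing the minimal sufficient one\<close>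

lemma expected_R2_hat:
  fixes S :: "'a study"
  assumes wf: "wf_process S" and model: "output_model S" and eval: "independent_evaluation S"
    and M: "mask_star S \<subseteq> M" "M \<subseteq> all_inputs S"
    and bal: "balanced (prob S) (levels S) (inputs S) (train S) M"
  shows "N_s S > 0"
    and "integrable (prob S) (R2_hat S M)"
    and "prob_space.expectation (prob S) (R2_hat S M) =
      (noise_sd S)\<^sup>2 * (1 + real (num_cells (levels S) M) / real (N_s S))"
proof -
  define P F q X Y e \<mu> where "P = prob S" "F = all_inputs S" "q = levels S" "X = inputs S"
    "Y = outputs S" "e = noise S" "\<mu> = cell_mean S M"
  note defs = this
  \<comment> \<open>\<open>A\<close> holds the estimation times, \<open>E\<close> the evaluation
    times and \<open>T\<close> all of them: a residual mixes noise from both sets, so the noise has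
    to be treated as one family.\<close>
  define A E T where "A = train S" "E = test S" "T = train S \<union> test S"
  note time_defs = this
  define N K v where "N = real (card A)" "K = real (num_cells q M)" "v = (noise_sd S)\<^sup>2"
  note num_defs = this
  define SZ where "SZ = (\<Pi>\<^sub>M t\<in>T. count_space (cells q F))"
  \<comment> \<open>The joint full input symbols at all times; every cell membership, hence every
    coefficient below, is a function of \<open>Z\<close>.\<close>
  define Z where "Z = (\<lambda>\<omega>. \<lambda>t\<in>T. input_symbol X F t \<omega>)"
  interpret prob_space P using wf by (simp add: wf_process_def defs)
  have eval': "finite (train S)" "finite (test S)" "train S \<inter> test S = {}"
      "card (test S) = card (train S)"
    using eval unfolding independent_evaluation_def Let_def by blast+
  have fin: "finite A" "finite E" "finite T" and disj: "A \<inter> E = {}" and cardE: "real (card E) = N"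
    and AT: "A \<subseteq> T" "E \<subseteq> T"
    using eval' by (auto simp: time_defs num_defs)
  have MF: "M \<subseteq> F" using M by (simp add: defs)
  have Ym [measurable]: "Y t \<in> borel_measurable P" for t
    using wf by (simp add: wf_process_def defs)
  note model' = model[unfolded output_model_def Let_def, folded time_defs(3) defs(1-6), folded SZ_def Z_def]
  have sd: "noise_sd S > 0"
    and Y: "\<forall>t\<in>T. AE \<omega> in P. Y t \<omega> = \<mu> (input_symbol X M t \<omega>) + e t \<omega>"
    and dist: "\<And>t. t \<in> T \<Longrightarrow> distributed P lborel (e t) (normal_density 0 (noise_sd S))"
    and ie: "indep_vars (\<lambda>_. borel) e T"
    and ind: "indep_rv P (\<Pi>\<^sub>M t\<in>T. borel) (\<lambda>\<omega>. \<lambda>t\<in>T. e t \<omega>) SZ Z"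
    using model' M(1) MF unfolding defs(7) by blast+
  have finM: "finite M" using MF finite_full_mask finite_subset unfolding defs by blast
  have Zm: "Z \<in> P \<rightarrow>\<^sub>M SZ" using ind by (simp add: indep_rv_def)
  have comp: "(\<lambda>z. restrict (z t) M) \<in> SZ \<rightarrow>\<^sub>M count_space (cells q M)" if "t \<in> T" for t
  proof -
    have "(\<lambda>z. z t) \<in> SZ \<rightarrow>\<^sub>M count_space (cells q F)"
      unfolding SZ_def using that by simp
    then show ?thesis
      by (rule measurable_compose) (use restrict_in_cells[OF MF] in \<open>unfold measurable_count_space_eq1 space_count_space, blast\<close>)
  qed
  have ZM: "restrict (Z \<omega> t) M = input_symbol X M t \<omega>" if "t \<in> T" for t \<omega>
    using that by (simp add: Z_def input_symbol_restrict[OF MF])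
  have sym: "input_symbol X M t \<in> P \<rightarrow>\<^sub>M count_space (cells q M)" if "t \<in> T" for t
    using measurable_compose[OF Zm comp[OF that]] that by (simp add: ZM)
  have cnt: "countable (cells q M)" using finite_cells[OF finM] by (rule countable_finite)
  \<comment> \<open>Indicator that observations \<open>s\<close> and \<open>t\<close> share a cell
    of \<open>M\<close>.\<close>
  define w where "w s t \<omega> = (of_bool (input_symbol X M s \<omega> = input_symbol X M t \<omega>) :: real)" for s t \<omega>
  have wm [measurable]: "w s t \<in> borel_measurable P" if "s \<in> T" "t \<in> T" for s t
    using borel_measurable_of_bool_eq[OF sym[OF that(1)] sym[OF that(2)] cnt] unfolding w_def .
  define Q where "Q t \<omega> = (Y t \<omega> - (\<Sum>s\<in>A. w s t \<omega> * Y s \<omega>) / (\<Sum>s\<in>A. w s t \<omega>))\<^sup>2" for t \<omega>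
  have R2: "R2_hat S M = (\<lambda>\<omega>. 1 / N * (\<Sum>t\<in>E. Q t \<omega>))"
  proof
    fix \<omega>
    have "R2_hat S M \<omega> = empirical_mse X Y A E M \<omega>"
      by (simp add: R2_hat_def defs time_defs)
    then show "R2_hat S M \<omega> = 1 / N * (\<Sum>t\<in>E. Q t \<omega>)"
      unfolding empirical_mse_def cell_average_eq_weighted[OF fin(1)] cardE Q_def w_def .
  qed
  have Qm: "Q t \<in> borel_measurable P" if "t \<in> T" for t
  proof -
    have [measurable]: "w s t \<in> borel_measurable P" if "s \<in> A" for s
      by (rule wm) (use that \<open>t \<in> T\<close> AT in auto)
    show ?thesis unfolding Q_def by measurable
  qed
  have K: "K > 0" using num_cells_pos[OF wf M(2)] by (simp add: num_defs defs)
  \<comment> \<open>Positivity of \<open>N\<close> is deterministic, but its proof needs an outcome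
    at which some cell is attained, so it is carried under the almost-everywhere quantifier and
    extracted afterwards. The time \<open>0\<close> used for this is arbitrary.\<close>
  have "AE \<omega> in P. N > 0 \<and> (\<forall>t\<in>T. (\<Sum>s\<in>A. w s t \<omega>) = N / K)"
  proof -
    have "AE \<omega> in P. \<forall>B\<in>cells q M. card (obs_in_cell X A M B \<omega>) \<ge> 1 \<and>
       real (card (obs_in_cell X A M B \<omega>)) = N / K"
      using bal unfolding balanced_def defs time_defs num_defs .
    with AE_space[of P] show ?thesis
    proof eventually_elim
      case (elim \<omega>)
      have cell: "input_symbol X M t \<omega> \<in> cells q M" for t
        using input_symbol_in_cells[OF wf M(2)] elim(1) by (simp add: defs)
      have "(\<Sum>s\<in>A. w s t \<omega>) = real (card (obs_in_cell X A M (input_symbol X M t \<omega>) \<omega>))" for t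
        using fin(1) by (simp add: w_def obs_in_cell_def of_bool_def sum.If_cases Int_def)
      moreover have "N > 0"
      proof (rule ccontr)
        assume "\<not> N > 0"
        then have "A = {}" using fin(1) by (simp add: num_defs)
        then show False using elim(2) cell[of 0] by (force simp: obs_in_cell_def)
      qed
      ultimately show ?case using elim(2) cell by simp
    qed
  qed
  then have N: "N > 0" and W: "AE \<omega> in P. \<forall>t\<in>T. (\<Sum>s\<in>A. w s t \<omega>) = N / K"
    by (auto simp: AE_conj_iff)
  show "N_s S > 0" using N by (simp add: N_s_def defs time_defs num_defs)
  \<comment> \<open>The random denominator of the cell average is replaced by its almost sure value
    \<open>N / K\<close>. The coefficients are thereby bounded everywhere, while agreement with the
    true residual is claimed only almost everywhere.\<close>
  define a where "a t s z = (of_bool (s = t) -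
      of_bool (s \<in> A) * of_bool (restrict (z s) M = restrict (z t) M) * (K / N) :: real)"
    for t s :: int and z :: "int \<Rightarrow> cell"
  have am: "a t s \<in> borel_measurable SZ" if "s \<in> T" "t \<in> T" for s t
    using borel_measurable_of_bool_eq[OF comp[OF that(1)] comp[OF that(2)] cnt]
    unfolding a_def by measurable
  have abd: "\<bar>a t s z\<bar> \<le> 1 + K / N" for s t z
  proof -
    have "0 < K / N" using K N by simp
    then show ?thesis unfolding a_def by (cases "s \<in> A") (auto simp del: zero_less_divide_iff)
  qed
  have aZ: "a t s (Z \<omega>) = of_bool (s = t) - of_bool (s \<in> A) * w s t \<omega> * (K / N)"
    if "s \<in> T" "t \<in> T" for s t \<omega>
    unfolding a_def ZM[OF that(1)] ZM[OF that(2)] w_def ..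
  have Yall: "AE \<omega> in P. \<forall>t\<in>T. Y t \<omega> = \<mu> (input_symbol X M t \<omega>) + e t \<omega>"
    using Y fin(3) by (simp add: AE_finite_all)
  have Q: "AE \<omega> in P. Q t \<omega> = (\<Sum>s\<in>T. a t s (Z \<omega>) * e s \<omega>)\<^sup>2"
    and a2: "AE \<omega> in P. (\<Sum>s\<in>T. (a t s (Z \<omega>))\<^sup>2) = 1 + K / N" if t: "t \<in> E" for t
  proof -
    have tT: "t \<in> T" and tA: "t \<notin> A" using t AT disj by auto
    have res: "(\<Sum>s\<in>T. of_bool (s \<in> A) * f s) = (\<Sum>s\<in>A. f s)" for f :: "int \<Rightarrow> real"
      using fin(3) AT by (simp add: of_bool_def sum.If_cases if_distrib[of "\<lambda>x. x * _"] Int_absorb1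
          cong: if_cong)
    have pt: "(\<Sum>s\<in>T. of_bool (s = t) * f s) = f t" for f :: "int \<Rightarrow> real"
      using fin(3) tT by (simp add: of_bool_def if_distrib[of "\<lambda>x. x * _"] cong: if_cong)
    show "AE \<omega> in P. Q t \<omega> = (\<Sum>s\<in>T. a t s (Z \<omega>) * e s \<omega>)\<^sup>2"
      using Yall W
    proof eventually_elim
      case (elim \<omega>)
      \<comment> \<open>Where the weight is nonzero, \<open>s\<close> lies in the cell of
        \<open>t\<close> and has the same cell mean. The weights sum to \<open>N / K\<close>, so
        dividing returns exactly this mean, which cancels against that of
        \<open>Y t\<close>.\<close>
      have "(\<Sum>s\<in>A. w s t \<omega> * Y s \<omega>)
          = (\<Sum>s\<in>A. w s t \<omega> * \<mu> (input_symbol X M t \<omega>) + w s t \<omega> * e s \<omega>)"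
        using elim(1) AT by (intro sum.cong refl) (auto simp: w_def)
      also have "\<dots> = N / K * \<mu> (input_symbol X M t \<omega>) + (\<Sum>s\<in>A. w s t \<omega> * e s \<omega>)"
        using elim(2) tT by (simp add: sum.distrib flip: sum_distrib_right)
      finally have sumY: "(\<Sum>s\<in>A. w s t \<omega> * Y s \<omega>)
          = N / K * \<mu> (input_symbol X M t \<omega>) + (\<Sum>s\<in>A. w s t \<omega> * e s \<omega>)" .
      have Yt: "Y t \<omega> = \<mu> (input_symbol X M t \<omega>) + e t \<omega>" and Wt: "(\<Sum>s\<in>A. w s t \<omega>) = N / K"
        using elim tT by auto
      have "Y t \<omega> - (\<Sum>s\<in>A. w s t \<omega> * Y s \<omega>) / (\<Sum>s\<in>A. w s t \<omega>)
          = e t \<omega> - K / N * (\<Sum>s\<in>A. w s t \<omega> * e s \<omega>)"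
        unfolding sumY Yt Wt using K N by (simp add: field_simps)
      also have "\<dots> = (\<Sum>s\<in>T. of_bool (s = t) * e s \<omega>) -
          (\<Sum>s\<in>T. of_bool (s \<in> A) * (K / N * (w s t \<omega> * e s \<omega>)))"
        unfolding pt res by (simp add: sum_distrib_left)
      also have "\<dots> = (\<Sum>s\<in>T. a t s (Z \<omega>) * e s \<omega>)"
        unfolding sum_subtractf[symmetric] using tT
        by (intro sum.cong refl) (simp add: aZ algebra_simps)
      finally show ?case by (simp add: Q_def)
    qed
    show "AE \<omega> in P. (\<Sum>s\<in>T. (a t s (Z \<omega>))\<^sup>2) = 1 + K / N"
      using W
    proof eventually_elim
      case (elim \<omega>)
      \<comment> \<open>As \<open>t\<close> is not in \<open>A\<close>, its own weight 1 and the
        training weights have disjoint supports and the squares produce no cross term. The 0/1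
        weight \<open>w\<close> equals its square.\<close>
      have "(\<Sum>s\<in>T. (a t s (Z \<omega>))\<^sup>2)
          = (\<Sum>s\<in>T. of_bool (s = t) * 1 + of_bool (s \<in> A) * ((K / N)\<^sup>2 * w s t \<omega>))"
        using tT tA by (intro sum.cong refl) (auto simp: aZ w_def)
      also have "\<dots> = 1 + (K / N)\<^sup>2 * (N / K)"
        unfolding sum.distrib pt res using elim tT by (simp flip: sum_distrib_left)
      finally show ?case using K N by (simp add: power2_eq_square)
    qed
  qed
  note moments = centered_normal_second_moments[OF sd ie dist]
  note combination = second_moment_random_combination[OF fin(3) ind moments am abd]
  have Qint: "integrable P (Q t)" and Qexp: "expectation (Q t) = v * (1 + K / N)"
    if t: "t \<in> E" for t
  proof -
    have tT: "t \<in> T" using t AT by auto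
    have int: "integrable P (\<lambda>\<omega>. (\<Sum>s\<in>T. a t s (Z \<omega>) * e s \<omega>)\<^sup>2)"
      by (rule combination(1)) (use tT in auto)
    show "integrable P (Q t)"
      by (rule integrable_cong_AE_imp[OF int Qm[OF tT]]) (use Q[OF t] in \<open>eventually_elim, simp\<close>)
    have "expectation (Q t) = expectation (\<lambda>\<omega>. (\<Sum>s\<in>T. a t s (Z \<omega>) * e s \<omega>)\<^sup>2)"
      by (rule integral_cong_AE[OF Qm[OF tT] borel_measurable_integrable[OF int] Q[OF t]])
    also have "\<dots> = v * expectation (\<lambda>\<omega>. \<Sum>s\<in>T. (a t s (Z \<omega>))\<^sup>2)"
      unfolding num_defs by (rule combination(2)) (use tT in auto)
    \<comment> \<open>Balance makes the sum of squares almost surely constant, so the distribution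
      of the inputs drops out.\<close>
    also have "expectation (\<lambda>\<omega>. \<Sum>s\<in>T. (a t s (Z \<omega>))\<^sup>2) = expectation (\<lambda>\<omega>. 1 + K / N)"
    proof (rule integral_cong_AE[OF _ _ a2[OF t]])
      have "(\<lambda>\<omega>. a t s (Z \<omega>)) \<in> borel_measurable P" if "s \<in> T" for s
        using measurable_compose[OF Zm am[OF that tT]] .
      then show "(\<lambda>\<omega>. \<Sum>s\<in>T. (a t s (Z \<omega>))\<^sup>2) \<in> borel_measurable P" by measurable
    qed simp
    finally show "expectation (Q t) = v * (1 + K / N)" by (simp add: prob_space)
  qed
  have "integrable P (R2_hat S M)" unfolding R2 using Qint by auto
  then show "integrable (study.prob S) (R2_hat S M)" by (simp add: defs)
  have "expectation (R2_hat S M) = v * (1 + K / N)"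
    unfolding R2 using Qint Qexp N cardE by (simp add: Bochner_Integration.integral_sum)
  then show "prob_space.expectation (study.prob S) (R2_hat S M) =
      (noise_sd S)\<^sup>2 * (1 + real (num_cells (levels S) M) / real (N_s S))"
    by (simp add: defs num_defs time_defs N_s_def)
qed

section \<open>Difference of the two errors and its monotonicity\<close>

text \<open>Both expectations contain the same irreducible noise variance, which cancels; only the
  terms proportional to the cell counts survive.\<close>

lemma delta_formula:
  fixes S :: "'a study"
  assumes "balanced_study S"
  shows "integrable (prob S) (R2_hat S (mask_ent S))"
    and "integrable (prob S) (R2_hat S (mask_star S))"
    and "\<delta> S = (noise_sd S)\<^sup>2 / real (N_s S) * cell_excess S"
    and "N_s S > 0"
    and "cell_excess S \<ge> 0"
proof -
  \<comment> \<open>As a minimizer, \<open>mask_ent S\<close> belongs to the candidates and is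
    therefore a subset of all inputs.\<close>
  have wf: "wf_process S" and model: "output_model S" and eval: "independent_evaluation S"
    and sub: "mask_star S \<subseteq> mask_ent S"
    and bal: "balanced (prob S) (levels S) (inputs S) (train S) (mask_ent S)"
      "balanced (prob S) (levels S) (inputs S) (train S) (mask_star S)"
    and ent: "mask_ent S \<subseteq> all_inputs S"
    using assms by (auto simp: balanced_study_def entropy_selected_def is_arg_min_def)
  note E = expected_R2_hat[OF wf model eval sub ent bal(1)]
  note Star = expected_R2_hat[OF wf model eval subset_refl subset_trans[OF sub ent] bal(2)]
  show "integrable (prob S) (R2_hat S (mask_ent S))" by (rule E)
  show "integrable (prob S) (R2_hat S (mask_star S))" by (rule Star)
  show "N_s S > 0" by (rule E)
  show "\<delta> S = (noise_sd S)\<^sup>2 / real (N_s S) * cell_excess S"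
    unfolding \<delta>_def E Star cell_excess_def using E(1) by (simp add: field_simps)
  show "cell_excess S \<ge> 0"
    using num_cells_mono[OF wf sub ent] by (simp add: cell_excess_def)
qed

text \<open>Monotonicity is a comparison of two studies, possibly on different sample spaces, that
  agree in the other two parameters. Integrability is asserted because the integral of a
  non-integrable function is 0 by convention.\<close>

theorem theorem2:
  fixes S :: "'a study"
  assumes "balanced_study S"
  shows "integrable (prob S) (R2_hat S (mask_ent S)) \<and>
         integrable (prob S) (R2_hat S (mask_star S)) \<and>
         \<delta> S = (noise_sd S)\<^sup>2 / real (N_s S) * cell_excess S \<and>
         \<delta> S \<ge> 0 \<and>
         (\<forall>S' :: 'b study. balanced_study S' \<longrightarrow>
            (N_s S = N_s S' \<and> noise_sd S = noise_sd S' \<and> cell_excess S \<le> cell_excess S'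
               \<longrightarrow> \<delta> S \<le> \<delta> S') \<and>
            (N_s S = N_s S' \<and> cell_excess S = cell_excess S' \<and> (noise_sd S)\<^sup>2 \<le> (noise_sd S')\<^sup>2
               \<longrightarrow> \<delta> S \<le> \<delta> S') \<and>
            (noise_sd S = noise_sd S' \<and> cell_excess S = cell_excess S' \<and> N_s S \<le> N_s S'
               \<longrightarrow> \<delta> S' \<le> \<delta> S))"
proof (intro conjI allI impI)
  note D = delta_formula[OF assms]
  show "integrable (prob S) (R2_hat S (mask_ent S))" "integrable (prob S) (R2_hat S (mask_star S))"
    "\<delta> S = (noise_sd S)\<^sup>2 / real (N_s S) * cell_excess S"
    by (fact D)+
  show "\<delta> S \<ge> 0" using D by simp
  fix S' :: "'b study" assume "balanced_study S'"
  note D' = delta_formula[OF this]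
  show "\<delta> S \<le> \<delta> S'"
    if "N_s S = N_s S' \<and> noise_sd S = noise_sd S' \<and> cell_excess S \<le> cell_excess S'"
    unfolding D(3) D'(3) using that by (auto simp del: times_divide_eq_left intro!: mult_left_mono)
  \<comment> \<open>The common excess is a nonnegative factor, so the order of the variances is
    preserved.\<close>
  show "\<delta> S \<le> \<delta> S'"
    if "N_s S = N_s S' \<and> cell_excess S = cell_excess S' \<and> (noise_sd S)\<^sup>2 \<le> (noise_sd S')\<^sup>2"
    unfolding D(3) D'(3) using that D'(5) by (auto intro!: mult_right_mono divide_right_mono)
  \<comment> \<open>Positivity of the smaller sample size matters here: division by 0 would give 0
    and break antitonicity.\<close>
  show "\<delta> S' \<le> \<delta> S"
    if "noise_sd S = noise_sd S' \<and> cell_excess S = cell_excess S' \<and> N_s S \<le> N_s S'"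
    unfolding D(3) D'(3) using that D(4) D'(5) by (auto intro!: mult_right_mono divide_left_mono)
qed

end
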